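(* Let $n\geq 2$ be an integer. Then for every integer $k > \max(3,(n-1)^2+1)$, $$a^r_n(k) = 2a^r_n(k-1)-a^r_n(k-2).$$
   Context: For integers $n\geq 1$ and $k\geq 0$, the $n$ by $k$ grid is the set of points $\{1,\dots,n\}\times\{1,\dots,k\}\subset\mathbb{R}^2$ (empty if $k=0$). $a^r_n(k)$ denotes the number of right isosceles triangles of nonzero area formed by 3 distinct points of the $n$ by $k$ grid, i.e. the number of 3-element non-collinear subsets of the grid that are the vertices of a triangle with at least two sides of equal Euclidean length and with one angle equal to $90^\circ$. *)

theory Defs
  imports "HOL-Analysis.Analysis"
begin

definition grid :: "nat \<Rightarrow> nat \<Rightarrow> (real \<times> real) set" where
  "grid n k = (\<lambda>(i, j). (real i, real j)) ` ({1..n} \<times> {1..k})"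

text \<open>The angle at the vertex \<open>A\<close> between the rays towards \<open>B\<close> and \<open>C\<close>, in radians;
  meaningful only for \<open>B \<noteq> A\<close> and \<open>C \<noteq> A\<close>.\<close>

definition angle_at :: "real \<times> real \<Rightarrow> real \<times> real \<Rightarrow> real \<times> real \<Rightarrow> real" where
  "angle_at A B C = arccos (((B - A) \<bullet> (C - A)) / (norm (B - A) * norm (C - A)))"

text \<open>A triangle of nonzero area is identified with its set of vertices. Since this set has
  three elements, the points \<open>A\<close>, \<open>B\<close>, \<open>C\<close> in the next definitions
  are automatically distinct.\<close>

definition is_triangle :: "(real \<times> real) set \<Rightarrow> bool" where
  "is_triangle T \<longleftrightarrow> card T = 3 \<and> \<not> collinear T"

definition isosceles :: "(real \<times> real) set \<Rightarrow> bool" where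
  "isosceles T \<longleftrightarrow> is_triangle T \<and> (\<exists>A B C. T = {A, B, C} \<and> dist A B = dist A C)"

definition right_angled :: "(real \<times> real) set \<Rightarrow> bool" where
  "right_angled T \<longleftrightarrow> is_triangle T \<and> (\<exists>A B C. T = {A, B, C} \<and> angle_at A B C = pi / 2)"

definition right_isosceles_count :: "nat \<Rightarrow> nat \<Rightarrow> nat" where
  "right_isosceles_count n k = card {T. T \<subseteq> grid n k \<and> isosceles T \<and> right_angled T}"

end

theory Submission
  imports Defs
begin

text \<open>
  The legs of a right isosceles triangle are plane vectors related by a quarter turn, so the
  height of one leg is the width of the other. A triangle whose vertices lie in \<open>n\<close> columns
  therefore has vertical extent at most \<open>2 * (n - 1)\<close>
  (\<open>right_isosceles_in_grid_height_le\<close>), and the hypothesis on \<open>k\<close> makes this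
  smaller than \<open>k - 1\<close>, the distance between the bottom and the top row. Hence every triangle in
  the \<open>n\<close> by \<open>k\<close> grid avoids one of these two rows: it lies in the lower or in the upper copy of
  the \<open>n\<close> by \<open>k - 1\<close> grid. The two copies meet in a copy of the \<open>n\<close> by \<open>k - 2\<close> grid,
  translations preserve the number of triangles (\<open>card_right_isosceles_in_translation\<close>), and
  the recurrence is inclusion--exclusion for these two families of triangles.
\<close>

definition right_isosceles_in :: "(real \<times> real) set \<Rightarrow> (real \<times> real) set set" where
  "right_isosceles_in X = {T. T \<subseteq> X \<and> isosceles T \<and> right_angled T}"

lemma right_isosceles_in_Int:
  "right_isosceles_in (X \<inter> Y) = right_isosceles_in X \<inter> right_isosceles_in Y"
  by (auto simp: right_isosceles_in_def)

lemma finite_right_isosceles_in: "finite X \<Longrightarrow> finite (right_isosceles_in X)"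
  by (rule finite_subset[of _ "Pow X"]) (auto simp: right_isosceles_in_def)


section \<open>Translation invariance\<close>

lemma collinear_translation: "collinear ((+) c ` S) \<longleftrightarrow> collinear S"
  by (simp add: collinear_def)

lemma is_triangle_translation: "is_triangle ((+) c ` T) \<longleftrightarrow> is_triangle T"
  by (simp add: is_triangle_def card_image collinear_translation)

lemma isosceles_translation:
  assumes "isosceles T"
  shows "isosceles ((+) c ` T)"
proof -
  obtain A B C where "is_triangle T" "T = {A, B, C}" "dist A B = dist A C"
    using assms unfolding isosceles_def by blast
  then have "is_triangle ((+) c ` T)" "(+) c ` T = {c + A, c + B, c + C}"
    "dist (c + A) (c + B) = dist (c + A) (c + C)"
    by (simp_all only: is_triangle_translation) (simp_all add: dist_norm)
  then show ?thesis
    unfolding isosceles_def by blast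
qed

lemma right_angled_translation:
  assumes "right_angled T"
  shows "right_angled ((+) c ` T)"
proof -
  obtain A B C where "is_triangle T" "T = {A, B, C}" "angle_at A B C = pi / 2"
    using assms unfolding right_angled_def by blast
  then have "is_triangle ((+) c ` T)" "(+) c ` T = {c + A, c + B, c + C}"
    "angle_at (c + A) (c + B) (c + C) = pi / 2"
    by (simp_all only: is_triangle_translation) (simp_all add: angle_at_def)
  then show ?thesis
    unfolding right_angled_def by blast
qed

lemma card_right_isosceles_in_translation:
  "card (right_isosceles_in ((+) c ` X)) = card (right_isosceles_in X)"
proof -
  have image_subset: "image ((+) d) ` right_isosceles_in Y \<subseteq> right_isosceles_in ((+) d ` Y)" for d Y
    by (auto simp: right_isosceles_in_def isosceles_translation right_angled_translation)
  have "right_isosceles_in ((+) c ` X) \<subseteq> image ((+) c) ` right_isosceles_in X"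
  proof
    fix T assume "T \<in> right_isosceles_in ((+) c ` X)"
    then have "(+) (- c) ` T \<in> right_isosceles_in X"
      using image_subset[of "- c" "(+) c ` X"] by (auto simp: image_image)
    moreover have "T = (+) c ` (+) (- c) ` T"
      by (simp add: image_image)
    ultimately show "T \<in> image ((+) c) ` right_isosceles_in X"
      by (rule rev_image_eqI)
  qed
  with image_subset[of c X]
  have "right_isosceles_in ((+) c ` X) = image ((+) c) ` right_isosceles_in X"
    by blast
  moreover have "inj_on (image ((+) c)) (right_isosceles_in X)"
    by (rule inj_onI) (simp add: inj_image_eq_iff)
  ultimately show ?thesis
    by (simp add: card_image)
qed


section \<open>The height of a right isosceles triangle\<close>

text \<open>Perpendicular plane vectors of equal length are related by a quarter turn.\<close>

lemma perpendicular_equal_norm_abs_snd_eq_abs_fst: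
  fixes u v :: "real \<times> real"
  assumes "u \<bullet> v = 0" "norm u = norm v"
  shows "\<bar>snd u\<bar> = \<bar>fst v\<bar>"
proof (cases "u = 0")
  case True
  then show ?thesis using assms by simp
next
  case False
  obtain a b c d where uv: "u = (a, b)" "v = (c, d)"
    by fastforce
  have perp: "a * c + b * d = 0"
    using assms(1) by (simp add: uv)
  have len: "a^2 + b^2 = c^2 + d^2"
    using assms(2) by (simp add: uv norm_Pair)
  have "(a^2 + b^2) * (c^2 - b^2) = (a * c + b * d) * (a * c - b * d)
          - b^2 * (a^2 + b^2 - (c^2 + d^2))"
    by algebra
  then have "(a^2 + b^2) * (c^2 - b^2) = 0"
    using perp len by simp
  moreover have "a^2 + b^2 \<noteq> 0"
    using False by (auto simp: uv sum_power2_eq_zero_iff zero_prod_def)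
  ultimately have "c^2 = b^2"
    by (simp only: mult_eq_0_iff) simp
  then show ?thesis
    by (auto simp: uv power2_eq_iff)
qed

lemma angle_at_eq_right_imp_inner_eq_0:
  assumes "angle_at A B C = pi / 2" "B \<noteq> A" "C \<noteq> A"
  shows "(B - A) \<bullet> (C - A) = 0"
proof -
  let ?x = "((B - A) \<bullet> (C - A)) / (norm (B - A) * norm (C - A))"
  \<comment> \<open>By Cauchy--Schwarz the argument lies where \<open>arccos\<close> is inverse to \<open>cos\<close>.\<close>
  have "\<bar>?x\<bar> \<le> 1"
    using Cauchy_Schwarz_ineq2[of "B - A" "C - A"] assms(2,3)
    by (simp add: abs_mult divide_le_eq)
  then have "?x = cos (angle_at A B C)"
    by (simp add: angle_at_def cos_arccos_abs)
  then have "?x = 0"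
    by (simp only: assms(1) cos_pi_half)
  with assms(2,3) show ?thesis
    by simp
qed

text \<open>The definitions allow the right angle and the apex between the equal sides to be different
  vertices. By Pythagoras the hypotenuse is longer than each leg, so the two equal sides are the
  legs and the right angle is at the apex.\<close>

lemma right_isosceles_legs:
  assumes "isosceles T" "right_angled T"
  obtains A B C where "T = {A, B, C}" "(B - A) \<bullet> (C - A) = 0" "norm (B - A) = norm (C - A)"
proof -
  obtain A B C where T: "T = {A, B, C}" and angle: "angle_at A B C = pi / 2"
    using assms(2) unfolding right_angled_def by blast
  have "card T = 3"
    using assms(1) by (simp add: isosceles_def is_triangle_def)
  then have dist: "A \<noteq> B" "A \<noteq> C" "B \<noteq> C"
    by (auto simp: T card_insert_if split: if_splits)
  have perp: "(B - A) \<bullet> (C - A) = 0"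
    using angle_at_eq_right_imp_inner_eq_0[OF angle] dist by simp
  have pythagoras: "(dist B C)^2 = (dist A B)^2 + (dist A C)^2"
    using perp by (simp add: dist_norm power2_norm_eq_inner inner_diff inner_commute)
  have "(dist A B)^2 > 0" "(dist A C)^2 > 0"
    using dist by simp_all
  with pythagoras have hyp: "dist B C \<noteq> dist A B" "dist B C \<noteq> dist A C"
    by auto
  obtain P Q R where PQR: "T = {P, Q, R}" "dist P Q = dist P R"
    using assms(1) unfolding isosceles_def by blast
  have "Q \<noteq> R" "P \<noteq> Q" "P \<noteq> R"
    using \<open>card T = 3\<close> by (auto simp: PQR card_insert_if split: if_splits)
  moreover have "P \<in> {A, B, C}" "Q \<in> {A, B, C}" "R \<in> {A, B, C}"
    using PQR(1) T by auto
  ultimately have "dist A B = dist A C"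
    using PQR(2) hyp by (auto simp: dist_commute)
  with T perp show ?thesis
    by (intro that[of A B C]) (simp_all add: dist_norm norm_minus_commute)
qed


section \<open>Triangles in the grid\<close>

lemma finite_grid: "finite (grid n k)"
  by (simp add: grid_def)

lemma right_isosceles_in_grid_height_le:
  assumes T: "T \<subseteq> grid n k" "isosceles T" "right_angled T" and PQ: "P \<in> T" "Q \<in> T"
  shows "\<bar>snd P - snd Q\<bar> \<le> 2 * (real n - 1)"
proof -
  obtain A B C where ABC: "T = {A, B, C}"
    and perp: "(B - A) \<bullet> (C - A) = 0" and len: "norm (B - A) = norm (C - A)"
    using right_isosceles_legs[OF T(2,3)] .
  have width: "\<bar>fst P - fst Q\<bar> \<le> real n - 1" if "P \<in> T" "Q \<in> T" for P Q
  proof -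
    have "fst p \<in> {1..real n}" if "p \<in> T" for p
      using T(1) that by (auto simp: grid_def)
    from this[OF that(1)] this[OF that(2)] show ?thesis
      by auto
  qed
  have "\<bar>snd (B - A)\<bar> = \<bar>fst (C - A)\<bar>"
    using perpendicular_equal_norm_abs_snd_eq_abs_fst[OF perp len] .
  moreover have "\<bar>snd (C - A)\<bar> = \<bar>fst (B - A)\<bar>"
    using perpendicular_equal_norm_abs_snd_eq_abs_fst[of "C - A" "B - A"] perp len
    by (simp add: inner_commute)
  ultimately have "\<bar>snd B - snd A\<bar> \<le> real n - 1" "\<bar>snd C - snd A\<bar> \<le> real n - 1"
    using width[of C A] width[of B A] by (simp_all add: ABC)
  with PQ show ?thesis
    by (auto simp: ABC abs_if split: if_splits)
qed

lemma right_isosceles_count_eq: "right_isosceles_count n k = card (right_isosceles_in (grid n k))"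
  by (simp add: right_isosceles_count_def right_isosceles_in_def)

lemma mem_shifted_grid_iff:
  "p \<in> (+) (0, 1) ` grid n k \<longleftrightarrow> p \<in> grid n (Suc k) \<and> snd p \<noteq> 1"
proof
  assume "p \<in> (+) (0, 1) ` grid n k"
  then obtain i j where "i \<in> {1..n}" "j \<in> {1..k}" "p = (real i, real (Suc j))"
    by (auto simp: grid_def)
  then show "p \<in> grid n (Suc k) \<and> snd p \<noteq> 1"
    unfolding grid_def by (auto intro!: image_eqI[of _ _ "(i, Suc j)"])
next
  assume "p \<in> grid n (Suc k) \<and> snd p \<noteq> 1"
  then obtain i j where ij: "i \<in> {1..n}" "j \<in> {1..Suc k}" "p = (real i, real j)" "j \<noteq> 1"
    by (auto simp: grid_def)
  then have "(real i, real (j - 1)) \<in> grid n k" "p = (0, 1) + (real i, real (j - 1))"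
    by (auto simp: grid_def of_nat_diff intro!: image_eqI[of _ _ "(i, j - 1)"])
  then show "p \<in> (+) (0, 1) ` grid n k"
    by blast
qed

lemma mem_grid_Suc_iff: "p \<in> grid n k \<longleftrightarrow> p \<in> grid n (Suc k) \<and> snd p \<noteq> real (Suc k)"
  by (auto simp: grid_def le_Suc_eq simp del: of_nat_Suc)

text \<open>The recurrence holds as soon as the grid is taller than every triangle in it.\<close>

lemma right_isosceles_count_recurrence:
  assumes tall: "2 * (real n - 1) < real (Suc m)"
  shows "right_isosceles_count n (Suc (Suc m)) + right_isosceles_count n m
           = 2 * right_isosceles_count n (Suc m)"
proof -
  let ?lower = "grid n (Suc m)"
  let ?upper = "(+) (0, 1) ` grid n (Suc m)"
  have sub: "?lower \<subseteq> grid n (Suc (Suc m))" "?upper \<subseteq> grid n (Suc (Suc m))"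
    using mem_grid_Suc_iff mem_shifted_grid_iff by blast+
  have "T \<subseteq> ?lower \<or> T \<subseteq> ?upper"
    if T: "T \<subseteq> grid n (Suc (Suc m))" "isosceles T" "right_angled T" for T
  proof (rule ccontr)
    assume "\<not> (T \<subseteq> ?lower \<or> T \<subseteq> ?upper)"
    then obtain P Q where "P \<in> T" "P \<notin> ?lower" "Q \<in> T" "Q \<notin> ?upper"
      by blast
    moreover from this have "snd P = real (Suc (Suc m))" "snd Q = 1"
      using T(1) mem_grid_Suc_iff[of P] mem_shifted_grid_iff[of Q] by blast+
    ultimately show False
      using right_isosceles_in_grid_height_le[OF T, of P Q] tall by simp
  qed
  with sub have union: "right_isosceles_in (grid n (Suc (Suc m)))
      = right_isosceles_in ?lower \<union> right_isosceles_in ?upper"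
    unfolding right_isosceles_in_def by blast
  have "?lower \<inter> ?upper = (+) (0, 1) ` grid n m"
  proof (rule set_eqI)
    fix p
    show "p \<in> ?lower \<inter> ?upper \<longleftrightarrow> p \<in> (+) (0, 1) ` grid n m"
      using mem_grid_Suc_iff[of p n "Suc m"] by (auto simp only: mem_shifted_grid_iff Int_iff)
  qed
  then have inter: "right_isosceles_in ?lower \<inter> right_isosceles_in ?upper
      = right_isosceles_in ((+) (0, 1) ` grid n m)"
    by (simp flip: right_isosceles_in_Int)
  have "card (right_isosceles_in ?lower) + card (right_isosceles_in ?upper)
      = card (right_isosceles_in (grid n (Suc (Suc m))))
        + card (right_isosceles_in ((+) (0, 1) ` grid n m))"
    unfolding union inter[symmetric]
    by (intro card_Un_Int finite_right_isosceles_in finite_grid finite_imageI)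
  then show ?thesis
    by (simp add: card_right_isosceles_in_translation right_isosceles_count_eq)
qed

theorem theorem5:
  fixes n k :: nat
  assumes "n \<ge> 2"
    and "k > max 3 ((n - 1)^2 + 1)"
  shows "int (right_isosceles_count n k) =
           2 * int (right_isosceles_count n (k - 1)) - int (right_isosceles_count n (k - 2))"
proof -
  obtain m where k: "k = Suc (Suc m)"
    using assms(2) by (metis Suc_lessD max_less_iff_conj numeral_3_eq_3 Suc_less_eq2)
  have "2 * (n - 1) < Suc m"
  proof (cases "n = 2")
    case True
    \<comment> \<open>Here the square falls short of twice its base, and the bound \<open>3 < k\<close> is decisive.\<close>
    then show ?thesis using assms(2) k by simp
  next
    case False
    with assms(1) have "2 * (n - 1) \<le> (n - 1)^2"
      by (simp add: power2_eq_square)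
    then show ?thesis using assms(2) k by simp
  qed
  then have "2 * (real n - 1) < real (Suc m)"
    using assms(1) by (simp add: of_nat_diff flip: of_nat_less_iff[where ?'a = real])
  then show ?thesis
    using right_isosceles_count_recurrence[of n m] k by simp
qed

end
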